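(* Let $\mathsf{G}^{\prime}$ be the undirected value graph on $\mathcal{V}$ with adjacency matrix $\mathbf{B}^{\prime}(u,v)=\gamma(u)\,\eta^{\prime}(u,v)\,\gamma(v)$ for all $u,v\in\mathcal{V}$, where $\eta^{\prime}$ is the lift-based outlierness influence and $\gamma$ is the subgraph density-based outlier factor. Let $\mathbf{W}^{b\prime}$ be the transition matrix $$\mathbf{W}^{b\prime}(u,v)=\frac{\gamma(v)\,\eta^{\prime}(u,v)}{\sum_{w\in\mathcal{V}}\gamma(w)\,\eta^{\prime}(u,w)},\qquad u,v\in\mathcal{V},$$ assumed well defined (all denominators nonzero). Put $d^{\prime}(v)=\sum_{u\in\mathcal{V}}\mathbf{B}^{\prime}(u,v)=\sum_{u\in\mathcal{V}}\gamma(v)\eta^{\prime}(u,v)\gamma(u)$ and $\mathrm{vol}(\mathsf{G}^{\prime})=\sum_{v\in\mathcal{V}}d^{\prime}(v)$. Then the vector $$\boldsymbol\pi^{*\prime}(v)=\frac{d^{\prime}(v)}{\mathrm{vol}(\mathsf{G}^{\prime})},\qquad v\in\mathcal{V},$$ is a stationary probability distribution of the random walk with transition matrix $\mathbf{W}^{b\prime}$, i.e. $\boldsymbol\pi^{*\prime}(v)=\sum_{u\in\mathcal{V}}\boldsymbol\pi^{*\prime}(u)\mathbf{W}^{b\prime}(u,v)$ for all $v\in\mathcal{V}$.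
   Context: Data. $\mathcal{X}=\{\mathbf{x}_1,\dots,\mathbf{x}_N\}$ is a finite set of $N$ data objects described by $D\ge 2$ categorical features $\mathsf{F}_1,\dots,\mathsf{F}_D$; $x_{ij}$ is the value of object $\mathbf{x}_i$ in feature $\mathsf{F}_j$. Each feature has a finite domain $\mathrm{dom}(\mathsf{F}_j)$, domains of different features are disjoint, and $\mathcal{V}=\bigcup_j \mathrm{dom}(\mathsf{F}_j)$. For $v\in\mathrm{dom}(\mathsf{F}_j)$, $\mathrm{freq}(v)=|\{i: x_{ij}=v\}|/N$; for $u\in\mathrm{dom}(\mathsf{F}_j)$, $v\in\mathrm{dom}(\mathsf{F}_k)$, $j\neq k$, $\mathrm{freq}(u,v)=|\{i: x_{ij}=u \text{ and } x_{ik}=v\}|/N$. Every value in $\mathcal{V}$ occurs in the data ($\mathrm{freq}(v)>0$), and no feature is constant on the data. Lift-based influence. $\eta^{\prime}(u,v)=\frac{\mathrm{freq}(u,v)}{\mathrm{freq}(u)\,\mathrm{freq}(v)}$ if $u,v$ belong to different features and $\eta^{\prime}(u,v)=0$ if they belong to the same feature. Thus $\eta^{\prime}\ge 0$ is symmetric. Intra-feature outlierness. The mode $m$ of a feature $\mathsf{F}$ is a value in $\mathrm{dom}(\mathsf{F})$ of maximal frequency (so $\mathrm{freq}(m)<1$). For $v\in\mathrm{dom}(\mathsf{F})$ with mode $m$, $\delta^{\prime}(v)=\tfrac12\left(1-\mathrm{freq}(m)+\frac{\mathrm{freq}(m)-\mathrm{freq}(v)}{\mathrm{freq}(m)}\right)\in(0,1)$,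 where $\tfrac12$ is a normalizing factor. Subgraph density-based outlier factor. For a node subset $S\subseteq\mathcal{V}$, the density of the induced subgraph $\mathsf{H}$ is $\mathrm{den}(\mathsf{H})=\frac{1}{2|S|}\sum_{u\in S}\sum_{v\in S}\delta^{\prime}(u)\eta^{\prime}(u,v)\delta^{\prime}(v)$. For each $k$ with $2\le k\le|\mathcal{V}|-1$, let $\mathsf{H}_k$ be the densest subgraph with exactly $k$ nodes (a fixed choice in case of ties), and let $\mathcal{G}=\{\mathsf{H}_2,\dots,\mathsf{H}_{|\mathcal{V}|-1}\}$. For $v\in\mathcal{V}$, let $\mathcal{G}_v$ be the set of members of $\mathcal{G}$ that contain $v$; then $\gamma(v)=\frac{1}{|\mathcal{G}_v|}\sum_{\mathsf{H}\in\mathcal{G}_v}\mathrm{den}(\mathsf{H})$, with $\gamma(v)=0$ if $\mathcal{G}_v=\emptyset$. *)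

theory Defs
  imports Complex_Main "HOL-Library.Disjoint_Sets"
begin

text \<open>
  Objects are indexed by \<open>{1..nobj C}\<close> and features by \<open>{1..nfeat C}\<close>. Distinct objects may have
  the same feature values; entries and domains at other indices are irrelevant.
\<close>

record 'v cdata =
  nobj :: nat
  nfeat :: nat
  entry :: "nat \<Rightarrow> nat \<Rightarrow> 'v"
  fdom :: "nat \<Rightarrow> 'v set"

definition vals :: "'v cdata \<Rightarrow> 'v set" where
  "vals C = (\<Union>j\<in>{1..nfeat C}. fdom C j)"

text \<open>Unique for \<open>v \<in> vals C\<close>, because domains of different features are disjoint.\<close>

definition feature_of :: "'v cdata \<Rightarrow> 'v \<Rightarrow> nat" where
  "feature_of C v = (THE j. j \<in> {1..nfeat C} \<and> v \<in> fdom C j)"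

definition freq :: "'v cdata \<Rightarrow> 'v \<Rightarrow> real" where
  "freq C v = real (card {i\<in>{1..nobj C}. entry C i (feature_of C v) = v}) / real (nobj C)"

definition joint_freq :: "'v cdata \<Rightarrow> 'v \<Rightarrow> 'v \<Rightarrow> real" where
  "joint_freq C u v =
     real (card {i\<in>{1..nobj C}. entry C i (feature_of C u) = u \<and> entry C i (feature_of C v) = v})
       / real (nobj C)"

definition categorical_data :: "'v cdata \<Rightarrow> bool" where
  "categorical_data C \<longleftrightarrow>
     nfeat C \<ge> 2 \<and>
     (\<forall>j\<in>{1..nfeat C}. finite (fdom C j)) \<and>
     disjoint_family_on (fdom C) {1..nfeat C} \<and>
     (\<forall>i\<in>{1..nobj C}. \<forall>j\<in>{1..nfeat C}. entry C i j \<in> fdom C j) \<and>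
     (\<forall>v\<in>vals C. freq C v > 0) \<and>
     (\<forall>j\<in>{1..nfeat C}. \<exists>i\<in>{1..nobj C}. \<exists>i'\<in>{1..nobj C}. entry C i j \<noteq> entry C i' j)"

definition lift_influence :: "'v cdata \<Rightarrow> 'v \<Rightarrow> 'v \<Rightarrow> real" where
  "lift_influence C u v =
     (if feature_of C u = feature_of C v then 0
      else joint_freq C u v / (freq C u * freq C v))"

text \<open>Only the frequency of the mode is used below, so the choice among ties is immaterial.\<close>

definition mode :: "'v cdata \<Rightarrow> nat \<Rightarrow> 'v" where
  "mode C j = arg_max_on (freq C) (fdom C j)"

definition intra_outlierness :: "'v cdata \<Rightarrow> 'v \<Rightarrow> real" where
  "intra_outlierness C v =
     (let m = mode C (feature_of C v)
      in 1/2 * (1 - freq C m + (freq C m - freq C v) / freq C m))"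

text \<open>An induced subgraph is represented by its node set.\<close>

definition den :: "'v cdata \<Rightarrow> 'v set \<Rightarrow> real" where
  "den C S = 1 / (2 * real (card S)) *
     (\<Sum>u\<in>S. \<Sum>v\<in>S. intra_outlierness C u * lift_influence C u v * intra_outlierness C v)"

text \<open>
  The function \<open>H\<close> is an arbitrary choice, for each admissible size \<open>k\<close>, of a densest induced
  subgraph among those with exactly \<open>k\<close> nodes.
\<close>

definition densest_choice :: "'v cdata \<Rightarrow> (nat \<Rightarrow> 'v set) \<Rightarrow> bool" where
  "densest_choice C H \<longleftrightarrow>
     (\<forall>k\<in>{2..card (vals C) - 1}. is_arg_max (den C) (\<lambda>S. S \<subseteq> vals C \<and> card S = k) (H k))"

definition dense_family :: "'v cdata \<Rightarrow> (nat \<Rightarrow> 'v set) \<Rightarrow> 'v set set" where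
  "dense_family C H = H ` {2..card (vals C) - 1}"

definition dense_family_at :: "'v cdata \<Rightarrow> (nat \<Rightarrow> 'v set) \<Rightarrow> 'v \<Rightarrow> 'v set set" where
  "dense_family_at C H v = {S \<in> dense_family C H. v \<in> S}"

definition outlier_factor :: "'v cdata \<Rightarrow> (nat \<Rightarrow> 'v set) \<Rightarrow> 'v \<Rightarrow> real" where
  "outlier_factor C H v =
     (if dense_family_at C H v = {} then 0
      else 1 / real (card (dense_family_at C H v)) * (\<Sum>S\<in>dense_family_at C H v. den C S))"

definition value_graph_adj :: "'v cdata \<Rightarrow> (nat \<Rightarrow> 'v set) \<Rightarrow> 'v \<Rightarrow> 'v \<Rightarrow> real" where
  "value_graph_adj C H u v = outlier_factor C H u * lift_influence C u v * outlier_factor C H v"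

definition transition_denom :: "'v cdata \<Rightarrow> (nat \<Rightarrow> 'v set) \<Rightarrow> 'v \<Rightarrow> real" where
  "transition_denom C H u = (\<Sum>w\<in>vals C. outlier_factor C H w * lift_influence C u w)"

definition transition_matrix :: "'v cdata \<Rightarrow> (nat \<Rightarrow> 'v set) \<Rightarrow> 'v \<Rightarrow> 'v \<Rightarrow> real" where
  "transition_matrix C H u v = outlier_factor C H v * lift_influence C u v / transition_denom C H u"

definition degree :: "'v cdata \<Rightarrow> (nat \<Rightarrow> 'v set) \<Rightarrow> 'v \<Rightarrow> real" where
  "degree C H v = (\<Sum>u\<in>vals C. value_graph_adj C H u v)"

definition vol :: "'v cdata \<Rightarrow> (nat \<Rightarrow> 'v set) \<Rightarrow> real" where
  "vol C H = (\<Sum>v\<in>vals C. degree C H v)"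

definition probability_vector :: "'a set \<Rightarrow> ('a \<Rightarrow> real) \<Rightarrow> bool" where
  "probability_vector A p \<longleftrightarrow> (\<forall>v\<in>A. p v \<ge> 0) \<and> (\<Sum>v\<in>A. p v) = 1"

definition stationary_distribution :: "'a set \<Rightarrow> ('a \<Rightarrow> 'a \<Rightarrow> real) \<Rightarrow> ('a \<Rightarrow> real) \<Rightarrow> bool" where
  "stationary_distribution A W p \<longleftrightarrow>
     probability_vector A p \<and> (\<forall>v\<in>A. p v = (\<Sum>u\<in>A. p u * W u v))"

end

theory Submission
  imports Defs
begin

text \<open>
  Since \<open>\<eta>'\<close> is symmetric, \<open>d'(v) = \<gamma>(v) D(v)\<close> where \<open>D(v)\<close> is the denominator of row \<open>v\<close> of
  the transition matrix; hence \<open>d'(u) W(u, v) = B'(u, v)\<close>, and summing over \<open>u\<close> gives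
  stationarity. All quantities are nonnegative, and \<open>vol > 0\<close>: a nonzero denominator forces
  \<open>\<gamma>(w) > 0\<close> for some \<open>w\<close>, so that \<open>d'(w) = \<gamma>(w) D(w) > 0\<close>.
\<close>

text \<open>Two distinct features containing \<open>v\<close> would contradict the disjointness of
  the domains, so the definite description in \<open>feature_of\<close> is met by \<open>j\<close>
  alone.\<close>

lemma feature_of_eq:
  assumes "categorical_data C" "j \<in> {1..nfeat C}" "v \<in> fdom C j"
  shows "feature_of C v = j"
  unfolding feature_of_def
proof (rule the_equality)
  show "k = j" if "k \<in> {1..nfeat C} \<and> v \<in> fdom C k" for k
  proof (rule ccontr)
    assume "k \<noteq> j"
    moreover have "disjoint_family_on (fdom C) {1..nfeat C}"
      using assms(1) by (simp add: categorical_data_def)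
    ultimately have "fdom C k \<inter> fdom C j = {}"
      using assms(2) that by (simp add: disjoint_family_on_def)
    then show False
      using assms(3) that by blast
  qed
qed (use assms in simp)

lemma finite_vals: "categorical_data C \<Longrightarrow> finite (vals C)"
  by (auto simp: vals_def categorical_data_def)

text \<open>A feature that is not constant on the data forces an object to exist, and the entry of
  that object is a value. This later starts the search for a vertex of positive degree.\<close>

lemma vals_nonempty:
  assumes "categorical_data C"
  shows "vals C \<noteq> {}"
proof -
  have j: "1 \<in> {1..nfeat C}"
    using assms by (auto simp: categorical_data_def)
  then obtain i where "i \<in> {1..nobj C}"
    using assms unfolding categorical_data_def by blast
  then have "entry C i 1 \<in> fdom C 1"
    using assms j unfolding categorical_data_def by blast
  with j show ?thesis
    unfolding vals_def by blast
qed

lemma freq_nonneg: "0 \<le> freq C v"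
  by (simp add: freq_def)

lemma freq_le_1: "freq C v \<le> 1"
proof -
  have "card {i\<in>{1..nobj C}. entry C i (feature_of C v) = v} \<le> card {1..nobj C}"
    by (intro card_mono) auto
  then show ?thesis
    \<comment> \<open>Without objects the quotient is \<open>0\<close>, by the convention for
      division by zero.\<close>
    by (cases "nobj C = 0") (simp_all add: freq_def divide_le_eq_1)
qed

text \<open>On a finite nonempty set the maximum is attained, so the choice behind
  \<open>arg_max_on\<close> has a witness and inherits its property.\<close>

lemma is_arg_max_arg_max_on:
  fixes f :: "'a \<Rightarrow> 'b::linorder"
  assumes "finite S" "S \<noteq> {}"
  shows "is_arg_max f (\<lambda>x. x \<in> S) (arg_max_on f S)"
proof -
  have "Max (f ` S) \<in> f ` S"
    using assms by simp
  then obtain x where "x \<in> S" "f x = Max (f ` S)"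
    by force
  then have "is_arg_max f (\<lambda>x. x \<in> S) x"
    using assms by (auto simp: is_arg_max_linorder)
  then show ?thesis
    unfolding arg_max_on_def arg_max_def by (rule someI)
qed

lemma intra_outlierness_nonneg:
  assumes "categorical_data C" "v \<in> vals C"
  shows "0 \<le> intra_outlierness C v"
proof -
  obtain j where j: "j \<in> {1..nfeat C}" "v \<in> fdom C j"
    using assms(2) by (auto simp: vals_def)
  have "finite (fdom C j)"
    using assms(1) j by (auto simp: categorical_data_def)
  then have "is_arg_max (freq C) (\<lambda>x. x \<in> fdom C j) (mode C j)"
    unfolding mode_def using j by (intro is_arg_max_arg_max_on) auto
  then have "freq C v \<le> freq C (mode C j)"
    using j by (auto simp: is_arg_max_linorder)
  then have "0 \<le> (freq C (mode C j) - freq C v) / freq C (mode C j)"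
    by (simp add: freq_nonneg)
  with freq_le_1[of C "mode C j"] show ?thesis
    by (simp add: intra_outlierness_def Let_def feature_of_eq[OF assms(1) j])
qed

lemma lift_influence_nonneg: "0 \<le> lift_influence C u v"
  by (simp add: lift_influence_def joint_freq_def freq_nonneg)

lemma lift_influence_commute: "lift_influence C u v = lift_influence C v u"
  by (simp add: lift_influence_def joint_freq_def conj_commute mult.commute)

lemma den_nonneg:
  assumes "categorical_data C" "S \<subseteq> vals C"
  shows "0 \<le> den C S"
  unfolding den_def
  by (intro mult_nonneg_nonneg sum_nonneg)
    (use assms in \<open>auto intro!: intra_outlierness_nonneg lift_influence_nonneg\<close>)

text \<open>Each chosen subgraph consists of values, so its density is nonnegative, and so is an
  average of such densities. If no chosen subgraph contains \<open>v\<close>, the default value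
  \<open>0\<close> applies.\<close>

lemma outlier_factor_nonneg:
  assumes "categorical_data C" "densest_choice C H"
  shows "0 \<le> outlier_factor C H v"
proof -
  have "0 \<le> den C S" if "S \<in> dense_family_at C H v" for S
  proof (rule den_nonneg[OF assms(1)])
    show "S \<subseteq> vals C"
      using that assms(2)
      by (auto simp: dense_family_at_def dense_family_def densest_choice_def is_arg_max_def)
  qed
  then show ?thesis
    by (simp add: outlier_factor_def sum_nonneg)
qed

lemma degree_eq: "degree C H v = outlier_factor C H v * transition_denom C H v"
  unfolding degree_def value_graph_adj_def transition_denom_def sum_distrib_left
  by (intro sum.cong refl) (simp add: lift_influence_commute[of C v] mult_ac)

theorem theorem2:
  fixes C :: "'v cdata" and H :: "nat \<Rightarrow> 'v set"
  assumes "categorical_data C"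
    and "densest_choice C H"
    and "\<forall>u\<in>vals C. transition_denom C H u \<noteq> 0"
  shows "stationary_distribution (vals C) (transition_matrix C H)
           (\<lambda>v. degree C H v / vol C H)"
proof -
  note \<gamma>_nonneg = outlier_factor_nonneg[OF assms(1,2)]
  have denom_pos: "0 < transition_denom C H u" if "u \<in> vals C" for u
  proof -
    have "0 \<le> transition_denom C H u"
      unfolding transition_denom_def
      by (intro sum_nonneg mult_nonneg_nonneg \<gamma>_nonneg lift_influence_nonneg)
    then show ?thesis
      using assms(3) that by force
  qed
  have degree_nonneg: "0 \<le> degree C H v" if "v \<in> vals C" for v
    using denom_pos[OF that] \<gamma>_nonneg[of v] by (simp add: degree_eq)
  obtain w where w: "w \<in> vals C" "outlier_factor C H w \<noteq> 0"
  proof -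
    obtain u where "u \<in> vals C"
      using vals_nonempty[OF assms(1)] by blast
    then have "transition_denom C H u \<noteq> 0"
      using assms(3) by blast
    then show ?thesis
      \<comment> \<open>The nonzero row sum of \<open>u\<close> has a nonzero summand, and its index
        serves as \<open>w\<close>. The vertex \<open>u\<close> itself may have outlier factor
        \<open>0\<close>.\<close>
      unfolding transition_denom_def using that by (auto elim: sum.not_neutral_contains_not_neutral)
  qed
  have "0 < degree C H w"
    using denom_pos[OF w(1)] \<gamma>_nonneg[of w] w(2) by (simp add: degree_eq)
  then have vol_pos: "0 < vol C H"
    unfolding vol_def using w(1) finite_vals[OF assms(1)] degree_nonneg by (intro sum_pos2)
  have "probability_vector (vals C) (\<lambda>v. degree C H v / vol C H)"
    using vol_pos degree_nonneg
    by (auto simp: probability_vector_def vol_def simp flip: sum_divide_distrib)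
  moreover have "degree C H v / vol C H =
      (\<Sum>u\<in>vals C. degree C H u / vol C H * transition_matrix C H u v)" for v
  proof -
    have "degree C H u * transition_matrix C H u v = value_graph_adj C H u v"
      if "u \<in> vals C" for u
      using denom_pos[OF that] by (simp add: degree_eq transition_matrix_def value_graph_adj_def)
    \<comment> \<open>\<open>degree\<close> sums over the first argument of the adjacency, so
      summing the flow from \<open>u\<close> to \<open>v\<close> over all \<open>u\<close> yields
      the degree of \<open>v\<close> directly.\<close>
    then show ?thesis
      by (simp add: degree_def[of C H v] sum_divide_distrib)
  qed
  ultimately show ?thesis
    unfolding stationary_distribution_def by blast
qed

end
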